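(* Let $f_{\theta,\alpha}:\mathbb{R}^n\to\mathbb{R}^n$ be a Learned Proximal Network (LPN) with potential $\Psi_{\theta,\alpha}$ and implicit regularizer $\varphi_{\theta,\alpha}$, let $\lambda\in(0,1)$, and let $f_{\theta,\alpha}^{(\lambda)}\coloneqq(1-\lambda)I_n+\lambda f_{\theta,\alpha}$, which is an LPN with potential $\Psi_{\theta,\alpha}^{(\lambda)}\coloneqq\lambda\Psi_{\theta,\alpha}+\frac{1-\lambda}{2}\|\cdot\|^2$ and implicit regularizer $\varphi_{\theta,\alpha}^{(\lambda)}\coloneqq(\Psi_{\theta,\alpha}^{(\lambda)})^*-\frac12\|\cdot\|^2$. Let $\mathbf{fid}:\mathbb{R}^n\to\mathbb{R}$ be $L_{\mathbf{fid}}$-smooth (differentiable with $L_{\mathbf{fid}}$-Lipschitz gradient, $L_{\mathbf{fid}}>0$) and bounded below, let $0<\eta<1/L_{\mathbf{fid}}$, let $x_0\in\mathbb{R}^n$, and define $$x_{k+1}\coloneqq f^{(\lambda)}_{\theta,\alpha}\bigl(x_k-\eta\nabla\mathbf{fid}(x_k)\bigr),\qquad k\ge0.$$ Let $F^{(\lambda)}\coloneqq\eta\,\mathbf{fid}+\lambda M_{1-\lambda}\varphi_{\theta,\alpha}$. Then $\varphi_{\theta,\alpha}^{(\lambda)}=\lambda M_{1-\lambda}\varphi_{\theta,\alpha}$, and the following hold: (i) $F^{(\lambda)}(x_k)$ is non-increasing and convergent. (ii) $\sum_{k=1}^{\infty}\|x_k-x_{k+1}\|^2<+\infty$. (iii)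 If in addition $F^{(\lambda)}$ is a KL function, then $\sum_{k=1}^{\infty}\|x_k-x_{k+1}\|<+\infty$ and $\{x_k\}_{k\ge1}$ converges to a critical point $x^*$ of $F^{(\lambda)}$.
   Context: Norms and inner products are Euclidean; $I_n$ is the identity map. For $h:\mathbb{R}^n\to\mathbb{R}$ and $\gamma>0$, the Moreau envelope is $M_\gamma h(y)\coloneqq\inf_x\{h(x)+\frac{1}{2\gamma}\|x-y\|^2\}$. ICNN: An input convex neural network is a function $\psi_\theta:\mathbb{R}^n\to\mathbb{R}$, $\psi_\theta(x)\coloneqq z_K$, where $z_{i+1}\coloneqq\sigma(W_iz_i+H_ix+b_i)$ for $i=0,\dots,K-1$, with $W_0,z_0\equiv 0$; here $H_i,W_i$ are linear maps (of compatible dimensions, $z_K$ scalar), each $W_i$ has non-negative entries, $b_i$ are bias vectors, and the activation $\sigma:\mathbb{R}\to\mathbb{R}$ is convex and non-decreasing, applied element-wise. LPN: $f_{\theta,\alpha}:\mathbb{R}^n\to\mathbb{R}^n$ is an LPN with strong convexity modulus $\alpha$ if $0<\alpha<1$ and $f_{\theta,\alpha}(y)\in\partial\psi_\theta(y)+\alpha y$ for all $y$, where $\psi_\theta$ is an ICNN with Lipschitz activation $\sigma$ and $\partial$ is the convex subdifferential. Its potential is $\Psi_{\theta,\alpha}\coloneqq\psi_\theta+\frac{\alpha}{2}\|\cdot\|^2$ and its implicit regularizer is $\varphi_{\theta,\alpha}\coloneqq\Psi_{\theta,\alpha}^*-\frac12\|\cdot\|^2$, where $\Psi^*(y)\coloneqq\sup_x\{\langle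 x,y\rangle-\Psi(x)\}$ is the convex conjugate. KL: A continuously differentiable $F:\mathbb{R}^d\to\mathbb{R}$ has the KL property at $x^*\in\mathbb{R}^d$ if there exist $\zeta\in(0,+\infty]$, a neighborhood $U$ of $x^*$, and a continuous concave function $\chi:[0,\zeta)\to[0,\infty)$ such that $\chi(0)=0$, $\chi\in C^1((0,\zeta))$, $\chi'(s)>0$ for all $s\in(0,\zeta)$, and $\chi'(F(x)-F(x^* ))\,\|\nabla F(x)\|\ge 1$ for every $x\in U$ with $F(x^* )<F(x)<F(x^* )+\zeta$. $F$ is a KL function if it has the KL property at every point of $\mathbb{R}^d$. *)

theory Defs
  imports "HOL-Analysis.Analysis"
begin

subsection \<open>Convex and smooth analysis\<close>

definition subdifferential :: "('a::real_inner \<Rightarrow> real) \<Rightarrow> 'a \<Rightarrow> 'a set" where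
  "subdifferential g y = {v. \<forall>z. g z \<ge> g y + v \<bullet> (z - y)}"

(* Real-valued conjugate and envelope: they have their usual meaning where the supremum
   (infimum) is finite. For the functions of an LPN it is finite everywhere; see
   lpn_conjugate_finite, relaxed_conjugate_finite and lpn_moreau_finite below. *)

definition convex_conjugate :: "('a::real_inner \<Rightarrow> real) \<Rightarrow> 'a \<Rightarrow> real" where
  "convex_conjugate g y = (SUP x. x \<bullet> y - g x)"

definition moreau_envelope :: "real \<Rightarrow> ('a::real_inner \<Rightarrow> real) \<Rightarrow> 'a \<Rightarrow> real" where
  "moreau_envelope \<gamma> h y = (INF x. h x + 1 / (2 * \<gamma>) * (norm (x - y))\<^sup>2)"

definition gradient :: "('a::euclidean_space \<Rightarrow> real) \<Rightarrow> 'a \<Rightarrow> 'a" where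
  "gradient F x = (THE v. GDERIV F x :> v)"

definition smooth_with :: "real \<Rightarrow> ('a::euclidean_space \<Rightarrow> real) \<Rightarrow> bool" where
  "smooth_with L F \<longleftrightarrow> (\<forall>x. F differentiable (at x)) \<and> L-lipschitz_on UNIV (gradient F)"

definition continuously_differentiable :: "('a::euclidean_space \<Rightarrow> real) \<Rightarrow> bool" where
  "continuously_differentiable F \<longleftrightarrow>
     (\<forall>x. F differentiable (at x)) \<and> continuous_on UNIV (gradient F)"

definition critical_point :: "('a::euclidean_space \<Rightarrow> real) \<Rightarrow> 'a \<Rightarrow> bool" where
  "critical_point F x \<longleftrightarrow> GDERIV F x :> 0"

subsection \<open>The Kurdyka--Lojasiewicz property\<close>

(* \<zeta> is extended real so that \<zeta> = \<infinity> is allowed; \<xi> is the desingularizing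
   function and \<xi>' its derivative. *)

definition KL_property_at :: "('a::euclidean_space \<Rightarrow> real) \<Rightarrow> 'a \<Rightarrow> bool" where
  "KL_property_at F x \<longleftrightarrow>
     (\<exists>(\<zeta>::ereal) U (\<xi>::real \<Rightarrow> real) \<xi>'.
        0 < \<zeta> \<and> x \<in> interior U \<and>
        continuous_on {s. 0 \<le> s \<and> ereal s < \<zeta>} \<xi> \<and>
        concave_on {s. 0 \<le> s \<and> ereal s < \<zeta>} \<xi> \<and>
        (\<forall>s. 0 \<le> s \<and> ereal s < \<zeta> \<longrightarrow> 0 \<le> \<xi> s) \<and>
        \<xi> 0 = 0 \<and>
        (\<forall>s. 0 < s \<and> ereal s < \<zeta> \<longrightarrow> (\<xi> has_real_derivative \<xi>' s) (at s)) \<and>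
        continuous_on {s. 0 < s \<and> ereal s < \<zeta>} \<xi>' \<and>
        (\<forall>s. 0 < s \<and> ereal s < \<zeta> \<longrightarrow> 0 < \<xi>' s) \<and>
        (\<forall>y\<in>U. F x < F y \<and> ereal (F y) < ereal (F x) + \<zeta> \<longrightarrow>
            1 \<le> \<xi>' (F y - F x) * norm (gradient F y)))"

definition KL_function :: "('a::euclidean_space \<Rightarrow> real) \<Rightarrow> bool" where
  "KL_function F \<longleftrightarrow> continuously_differentiable F \<and> (\<forall>x. KL_property_at F x)"

subsection \<open>Input convex neural networks\<close>

(* The i-th hidden state z_i is a function on nat of which only the components below
   width i are meaningful. weight i r c is the (r,c) entry of W_i; skip i r is the r-th row
   of H_i, so that the r-th component of H_i x is skip i r \<bullet> x; bias i r is the r-th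
   component of b_i. *)

record 'n icnn_params =
  depth :: nat
  width :: "nat \<Rightarrow> nat"
  weight :: "nat \<Rightarrow> nat \<Rightarrow> nat \<Rightarrow> real"
  skip :: "nat \<Rightarrow> nat \<Rightarrow> real ^ 'n"
  bias :: "nat \<Rightarrow> nat \<Rightarrow> real"

primrec icnn_state ::
  "(real \<Rightarrow> real) \<Rightarrow> 'n::finite icnn_params \<Rightarrow> real ^ 'n \<Rightarrow> nat \<Rightarrow> nat \<Rightarrow> real" where
  "icnn_state \<sigma> \<theta> x 0 = (\<lambda>r. 0)"
| "icnn_state \<sigma> \<theta> x (Suc i) =
     (\<lambda>r. \<sigma> ((\<Sum>c<width \<theta> i. weight \<theta> i r c * icnn_state \<sigma> \<theta> x i c) + skip \<theta> i r \<bullet> x + bias \<theta> i r))"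

definition icnn :: "(real \<Rightarrow> real) \<Rightarrow> 'n::finite icnn_params \<Rightarrow> real ^ 'n \<Rightarrow> real" where
  "icnn \<sigma> \<theta> x = icnn_state \<sigma> \<theta> x (depth \<theta>) 0"

definition is_icnn :: "(real \<Rightarrow> real) \<Rightarrow> 'n::finite icnn_params \<Rightarrow> bool" where
  "is_icnn \<sigma> \<theta> \<longleftrightarrow>
     convex_on UNIV \<sigma> \<and> mono \<sigma> \<and>
     width \<theta> (depth \<theta>) = 1 \<and>
     (\<forall>r c. weight \<theta> 0 r c = 0) \<and>
     (\<forall>i<depth \<theta>. \<forall>r<width \<theta> (Suc i). \<forall>c<width \<theta> i. 0 \<le> weight \<theta> i r c)"

subsection \<open>Learned proximal networks\<close>

definition is_lpn ::
  "(real \<Rightarrow> real) \<Rightarrow> 'n::finite icnn_params \<Rightarrow> real \<Rightarrow> (real ^ 'n \<Rightarrow> real ^ 'n) \<Rightarrow> bool" where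
  "is_lpn \<sigma> \<theta> \<alpha> f \<longleftrightarrow>
     0 < \<alpha> \<and> \<alpha> < 1 \<and> is_icnn \<sigma> \<theta> \<and> (\<exists>C. C-lipschitz_on UNIV \<sigma>) \<and>
     (\<forall>y. \<exists>v \<in> subdifferential (icnn \<sigma> \<theta>) y. f y = v + \<alpha> *\<^sub>R y)"

definition lpn_potential ::
  "(real \<Rightarrow> real) \<Rightarrow> 'n::finite icnn_params \<Rightarrow> real \<Rightarrow> real ^ 'n \<Rightarrow> real" where
  "lpn_potential \<sigma> \<theta> \<alpha> x = icnn \<sigma> \<theta> x + \<alpha> / 2 * (norm x)\<^sup>2"

definition implicit_regularizer :: "('a::real_inner \<Rightarrow> real) \<Rightarrow> 'a \<Rightarrow> real" where
  "implicit_regularizer \<Psi> y = convex_conjugate \<Psi> y - 1 / 2 * (norm y)\<^sup>2"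

definition relaxed_map :: "real \<Rightarrow> ('a::real_vector \<Rightarrow> 'a) \<Rightarrow> 'a \<Rightarrow> 'a" where
  "relaxed_map l f y = (1 - l) *\<^sub>R y + l *\<^sub>R f y"

definition relaxed_potential :: "real \<Rightarrow> ('a::real_inner \<Rightarrow> real) \<Rightarrow> 'a \<Rightarrow> real" where
  "relaxed_potential l \<Psi> x = l * \<Psi> x + (1 - l) / 2 * (norm x)\<^sup>2"

subsection \<open>Finiteness of the conjugates and envelopes\<close>

lemma quadratic_minorant_conjugate_finite:
  fixes G :: "'a::real_inner \<Rightarrow> real"
  assumes "0 < m" and G: "\<And>x. c + v \<bullet> x + m / 2 * (norm x)\<^sup>2 \<le> G x"
  shows "bdd_above (range (\<lambda>x. x \<bullet> y - G x))"
proof (rule bdd_aboveI2)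
  fix x
  have "0 \<le> (norm (m *\<^sub>R x - (y - v)))\<^sup>2 / (2 * m)"
    using \<open>0 < m\<close> by simp
  also have "\<dots> = m / 2 * (norm x)\<^sup>2 - x \<bullet> (y - v) + (norm (y - v))\<^sup>2 / (2 * m)"
  proof -
    have "(norm (m *\<^sub>R x - (y - v)))\<^sup>2 = m\<^sup>2 * (norm x)\<^sup>2 - 2 * m * (x \<bullet> (y - v)) + (norm (y - v))\<^sup>2"
      unfolding power2_norm_eq_inner
      by (simp add: inner_diff_left inner_diff_right inner_commute power2_eq_square algebra_simps)
    show ?thesis
      unfolding \<open>(norm (m *\<^sub>R x - (y - v)))\<^sup>2 = _\<close>
      using \<open>0 < m\<close> by (simp add: diff_divide_distrib add_divide_distrib power2_eq_square)
  qed
  finally show "x \<bullet> y - G x \<le> (norm (y - v))\<^sup>2 / (2 * m) - c"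
    using G[of x] by (simp add: inner_diff_right inner_commute)
qed

lemma lpn_potential_minorant:
  assumes "is_lpn \<sigma> \<theta> \<alpha> f"
  obtains v where
    "\<And>x. icnn \<sigma> \<theta> 0 + v \<bullet> x + \<alpha> / 2 * (norm x)\<^sup>2 \<le> lpn_potential \<sigma> \<theta> \<alpha> x"
proof -
  obtain v where "v \<in> subdifferential (icnn \<sigma> \<theta>) 0"
    using assms unfolding is_lpn_def by blast
  then show ?thesis
    by (intro that[of v]) (simp add: subdifferential_def lpn_potential_def)
qed

lemma lpn_conjugate_finite:
  assumes "is_lpn \<sigma> \<theta> \<alpha> f"
  shows "bdd_above (range (\<lambda>x. x \<bullet> y - lpn_potential \<sigma> \<theta> \<alpha> x))"
proof -
  obtain v where v: "\<And>x. icnn \<sigma> \<theta> 0 + v \<bullet> x + \<alpha> / 2 * (norm x)\<^sup>2 \<le> lpn_potential \<sigma> \<theta> \<alpha> x"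
    using lpn_potential_minorant[OF assms] by blast
  show ?thesis
    by (rule quadratic_minorant_conjugate_finite[OF _ v]) (use assms in \<open>simp add: is_lpn_def\<close>)
qed

lemma relaxed_conjugate_finite:
  assumes "is_lpn \<sigma> \<theta> \<alpha> f" and "0 < l" "l < 1"
  shows "bdd_above (range (\<lambda>x. x \<bullet> y - relaxed_potential l (lpn_potential \<sigma> \<theta> \<alpha>) x))"
proof -
  obtain v where v: "\<And>x. icnn \<sigma> \<theta> 0 + v \<bullet> x + \<alpha> / 2 * (norm x)\<^sup>2 \<le> lpn_potential \<sigma> \<theta> \<alpha> x"
    using lpn_potential_minorant[OF assms(1)] by blast
  have w: "l * icnn \<sigma> \<theta> 0 + (l *\<^sub>R v) \<bullet> x + (l * \<alpha> + (1 - l)) / 2 * (norm x)\<^sup>2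
      \<le> relaxed_potential l (lpn_potential \<sigma> \<theta> \<alpha>) x" for x
    using mult_left_mono[OF v[of x], of l] \<open>0 < l\<close>
    by (simp add: relaxed_potential_def algebra_simps add_divide_distrib diff_divide_distrib)
  have "0 < l * \<alpha> + (1 - l)"
    using assms by (simp add: is_lpn_def add_pos_pos)
  from quadratic_minorant_conjugate_finite[OF this w] show ?thesis .
qed

lemma lpn_moreau_finite:
  assumes "is_lpn \<sigma> \<theta> \<alpha> f" and "0 < \<gamma>" "\<gamma> < 1"
  shows "bdd_below (range (\<lambda>x. implicit_regularizer (lpn_potential \<sigma> \<theta> \<alpha>) x
           + 1 / (2 * \<gamma>) * (norm (x - y))\<^sup>2))"
proof (rule bdd_belowI2)
  fix x
  let ?P = "lpn_potential \<sigma> \<theta> \<alpha>"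
  have a: "y \<bullet> x - ?P y \<le> convex_conjugate ?P x"
    unfolding convex_conjugate_def by (rule cSUP_upper[OF _ lpn_conjugate_finite[OF assms(1)]]) simp
  have "1 / 2 * (norm (x - y))\<^sup>2 \<le> 1 / (2 * \<gamma>) * (norm (x - y))\<^sup>2"
    using assms by (intro mult_right_mono) (simp_all add: field_simps)
  moreover have "(norm (x - y))\<^sup>2 = (norm x)\<^sup>2 - 2 * (y \<bullet> x) + (norm y)\<^sup>2"
    by (simp add: power2_norm_eq_inner inner_diff inner_commute)
  ultimately show "1 / 2 * (norm y)\<^sup>2 - ?P y
      \<le> implicit_regularizer ?P x + 1 / (2 * \<gamma>) * (norm (x - y))\<^sup>2"
    using a unfolding implicit_regularizer_def by linarith
qed

end

theory Submission
  imports Defs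
begin

text \<open>
  Write \<open>H\<close> for the conjugate of \<open>\<Psi>l\<close>. As \<open>fl w\<close> is a subgradient of \<open>\<Psi>l\<close> at \<open>w\<close>, \<open>w\<close> is a
  subgradient of \<open>H\<close> at \<open>fl w\<close>, so the iteration is a proximal gradient step for
  \<open>F = \<eta> fid + H - |.|^2 / 2\<close>. The subgradient inequality and the descent lemma for \<open>fid\<close> give
  \<open>F (x k) - F (x (k+1)) \<ge> (1 - \<eta> L) / 2 |x (k+1) - x k|^2\<close>.
  A Lipschitz activation makes the network grow at most linearly, so \<open>\<Psi>l\<close> has quadratic growth with
  modulus below 1 and \<open>F\<close> is coercive; hence the values converge, the squared steps are
  summable and the iterates are bounded. Where \<open>F\<close> is differentiable, the subgradient of \<open>H\<close> must be
  its gradient, which yields \<open>|gradient F (x (k+1))| \<le> (1 + \<eta> L) |x (k+1) - x k|\<close>. The KL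
  inequality at a limit point then bounds the length of the trajectory.
\<close>

subsection \<open>Conjugates and the Moreau envelope\<close>

text \<open>A subgradient at the intermediate point gives an affine minorant touching
  \<open>g\<close> there; averaging its values at \<open>a\<close> and \<open>b\<close> returns
  exactly \<open>g y\<close>.\<close>

lemma convex_on_if_subgradients:
  fixes g :: "'a::real_inner \<Rightarrow> real"
  assumes "\<And>y. subdifferential g y \<noteq> {}"
  shows "convex_on UNIV g"
proof (rule convex_onI)
  fix t :: real and a b :: 'a
  assume t: "0 < t" "t < 1"
  define y where "y = (1 - t) *\<^sub>R a + t *\<^sub>R b"
  obtain v where v: "\<And>z. g z \<ge> g y + v \<bullet> (z - y)"
    using assms[of y] by (auto simp: subdifferential_def)
  have "(1 - t) * (g y + v \<bullet> (a - y)) + t * (g y + v \<bullet> (b - y)) \<le> (1 - t) * g a + t * g b"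
    using t v by (intro add_mono mult_left_mono) auto
  moreover have "(1 - t) * (g y + v \<bullet> (a - y)) + t * (g y + v \<bullet> (b - y))
      = g y + v \<bullet> ((1 - t) *\<^sub>R a + t *\<^sub>R b - y)"
    by (simp add: inner_diff_right inner_add_right algebra_simps)
  ultimately show "g ((1 - t) *\<^sub>R a + t *\<^sub>R b) \<le> (1 - t) * g a + t * g b"
    by (simp add: y_def)
qed simp

lemma conjugate_upper:
  assumes "bdd_above (range (\<lambda>x. x \<bullet> y - g x))"
  shows "x \<bullet> y - g x \<le> convex_conjugate g y"
  unfolding convex_conjugate_def by (rule cSUP_upper[OF _ assms]) simp

text \<open>Equality case of Fenchel-Young: the subgradient inequality says that \<open>u\<close>
  maximizes \<open>x \<bullet> v - g x\<close>.\<close>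

lemma conjugate_at_subgradient:
  assumes "v \<in> subdifferential g u"
  shows "convex_conjugate g v = u \<bullet> v - g u"
  unfolding convex_conjugate_def
proof (rule cSup_eq_maximum)
  fix r assume "r \<in> range (\<lambda>x. x \<bullet> v - g x)"
  then obtain x where "r = x \<bullet> v - g x" by blast
  moreover have "g u + v \<bullet> (x - u) \<le> g x" using assms unfolding subdifferential_def by blast
  ultimately show "r \<le> u \<bullet> v - g u"
    by (simp add: inner_diff_right inner_commute)
qed simp

text \<open>Equality at \<open>v\<close> is combined with Fenchel-Young at \<open>u\<close> for all
  other dual points. This inversion turns each iteration into a proximal step.\<close>

lemma subgradient_conjugate:
  assumes "v \<in> subdifferential g u" and "\<And>y. bdd_above (range (\<lambda>x. x \<bullet> y - g x))"
  shows "u \<in> subdifferential (convex_conjugate g) v"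
  unfolding subdifferential_def
  using conjugate_upper[OF assms(2), of u] conjugate_at_subgradient[OF assms(1)]
  by (auto simp: inner_diff_right)

lemma minimizer_if_quadratic_minorant:
  fixes G :: "'a::euclidean_space \<Rightarrow> real"
  assumes cont: "continuous_on UNIV G" and "0 < m"
    and G: "\<And>x. c + v \<bullet> x + m / 2 * (norm x)\<^sup>2 \<le> G x"
  obtains u where "\<And>z. G u \<le> G z"
proof -
  \<comment> \<open>Beyond radius \<open>R\<close> the quadratic term outweighs the linear term and
    the gap \<open>G 0 - c\<close>, so the minimum over the ball is global. The summand
    \<open>m\<close> forces \<open>R \<ge> 2\<close>, hence \<open>norm z > 1\<close> there.\<close>
  define R where "R = 2 * (norm v + \<bar>G 0 - c\<bar> + m) / m"
  have "R \<ge> 2" "R * m / 2 = norm v + \<bar>G 0 - c\<bar> + m"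
    using \<open>0 < m\<close> by (auto simp: R_def field_simps)
  obtain u where u: "u \<in> cball 0 R" "\<And>z. z \<in> cball 0 R \<Longrightarrow> G u \<le> G z"
    using continuous_attains_inf[of "cball (0::'a) R" G] continuous_on_subset[OF cont] \<open>R \<ge> 2\<close>
    by (auto simp: subset_UNIV)
  have "G u \<le> G z" for z
  proof (cases "norm z \<le> R")
    case False
    have "norm v + \<bar>G 0 - c\<bar> \<le> m / 2 * norm z"
      using False \<open>R * m / 2 = _\<close> \<open>0 < m\<close> mult_left_mono[of R "norm z" "m / 2"] by (simp add: mult.commute)
    then have "(norm v + \<bar>G 0 - c\<bar>) * norm z \<le> m / 2 * norm z * norm z"
      by (intro mult_right_mono) auto
    moreover have "\<bar>G 0 - c\<bar> * 1 \<le> \<bar>G 0 - c\<bar> * norm z"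
      using False \<open>R \<ge> 2\<close> by (intro mult_left_mono) auto
    moreover have "- (norm v * norm z) \<le> v \<bullet> z"
      using Cauchy_Schwarz_ineq2[of v z] by linarith
    ultimately have "G 0 \<le> c + v \<bullet> z + m / 2 * (norm z)\<^sup>2"
      by (simp add: power2_eq_square algebra_simps)
    then have "G 0 \<le> G z" using G[of z] by linarith
    then show ?thesis using u(2)[of 0] \<open>R \<ge> 2\<close> by auto
  qed (use u in auto)
  then show thesis by (rule that)
qed

lemma nonneg_if_nonneg_perturbation:
  fixes A B :: real
  assumes "\<And>t. 0 < t \<Longrightarrow> t \<le> 1 \<Longrightarrow> 0 \<le> A + t * B"
  shows "0 \<le> A"
proof (rule tendsto_lowerbound)
  show "((\<lambda>t. A + t * B) \<longlongrightarrow> A) (at_right 0)"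
    by (auto intro!: tendsto_eq_intros)
  show "\<forall>\<^sub>F t in at_right 0. 0 \<le> A + t * B"
    using eventually_at_right_less[of 0] eventually_at_right_real[OF zero_less_one]
    by eventually_elim (use assms in auto)
qed simp

text \<open>Test the inequality on the segment from \<open>u\<close> towards \<open>z\<close>:
  convexity bounds the change of \<open>P\<close> linearly in \<open>t\<close>, and the quadratic
  contributes its gradient plus a term of order \<open>t\<^sup>2\<close>. Divide by \<open>t\<close>
  and let \<open>t\<close> tend to 0.\<close>

lemma subgradient_remove_quadratic:
  fixes P :: "'a::real_inner \<Rightarrow> real"
  assumes conv: "convex_on UNIV P" and "0 < l"
    and y: "y \<in> subdifferential (relaxed_potential l P) u"
  shows "(1 / l) *\<^sub>R (y - (1 - l) *\<^sub>R u) \<in> subdifferential P u"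
  unfolding subdifferential_def
proof (rule CollectI, rule allI)
  fix z
  let ?A = "l * (P z - P u) - (y - (1 - l) *\<^sub>R u) \<bullet> (z - u)"
  have "0 \<le> ?A"
  proof (rule nonneg_if_nonneg_perturbation)
    fix t :: real assume t: "0 < t" "t \<le> 1"
    let ?w = "u + t *\<^sub>R (z - u)"
    have "P ((1 - t) *\<^sub>R u + t *\<^sub>R z) \<le> (1 - t) * P u + t * P z"
      using convex_onD[OF conv] t by auto
    moreover have "(1 - t) *\<^sub>R u + t *\<^sub>R z = ?w" by (simp add: algebra_simps)
    ultimately have "P ?w \<le> P u + t * (P z - P u)" by (simp add: algebra_simps)
    then have 1: "l * P ?w \<le> l * (P u + t * (P z - P u))"
      using \<open>0 < l\<close> by (intro mult_left_mono) auto
    have 2: "(norm ?w)\<^sup>2 = (norm u)\<^sup>2 + 2 * t * (u \<bullet> (z - u)) + t\<^sup>2 * (norm (z - u))\<^sup>2"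
      unfolding power2_norm_eq_inner
      by (simp add: inner_add_left inner_add_right inner_commute power2_eq_square algebra_simps)
    have "relaxed_potential l P u + y \<bullet> (?w - u) \<le> relaxed_potential l P ?w"
      using y unfolding subdifferential_def by blast
    then have "0 \<le> l * P ?w - l * P u + (1 - l) / 2 * ((norm ?w)\<^sup>2 - (norm u)\<^sup>2) - t * (y \<bullet> (z - u))"
      by (simp add: relaxed_potential_def right_diff_distrib)
    also have "\<dots> \<le> t * (?A + t * ((1 - l) / 2 * (norm (z - u))\<^sup>2))"
    proof -
      define p q where "p = P ?w" and "q = u \<bullet> (z - u)"
      show ?thesis
        using 1 unfolding 2 inner_diff_left inner_scaleR_left p_def[symmetric] q_def[symmetric]
        by (simp add: power2_eq_square field_simps)
    qed
    finally show "0 \<le> ?A + t * ((1 - l) / 2 * (norm (z - u))\<^sup>2)"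
      using t by (simp add: zero_le_mult_iff)
  qed
  then have "(y - (1 - l) *\<^sub>R u) \<bullet> (z - u) / l \<le> P z - P u"
    using \<open>0 < l\<close> by (simp add: pos_divide_le_eq mult.commute)
  then show "P u + (1 / l) *\<^sub>R (y - (1 - l) *\<^sub>R u) \<bullet> (z - u) \<le> P z"
    by simp
qed

text \<open>Conjugation turns an added quadratic into infimal convolution. The proof exhibits the
  optimizers: \<open>u\<close> attains the conjugate at \<open>y\<close>, and a subgradient
  \<open>x\<close> of \<open>P\<close> at \<open>u\<close> attains the envelope.\<close>

lemma implicit_regularizer_relaxed:
  fixes P :: "'a::euclidean_space \<Rightarrow> real"
  assumes sub: "\<And>y. subdifferential P y \<noteq> {}"
    and bdd: "\<And>y. bdd_above (range (\<lambda>x. x \<bullet> y - P x))"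
    and l: "0 < l" "l < 1"
  shows "implicit_regularizer (relaxed_potential l P) y
    = l * moreau_envelope (1 - l) (implicit_regularizer P) y"
proof -
  let ?Q = "relaxed_potential l P"
  have conv: "convex_on UNIV P" by (rule convex_on_if_subgradients[OF sub])
  have cont: "continuous_on UNIV P" by (rule convex_on_continuous[OF open_UNIV conv])
  obtain s where s: "\<And>z. P 0 + s \<bullet> z \<le> P z"
    using sub[of 0] by (auto simp: subdifferential_def)
  \<comment> \<open>An affine minorant of \<open>P\<close> leaves the quadratic of modulus
    \<open>1 - l\<close> in control, so the tilted potential has a minimizer.\<close>
  have "l * P 0 + (l *\<^sub>R s - y) \<bullet> z + (1 - l) / 2 * (norm z)\<^sup>2 \<le> ?Q z - y \<bullet> z" for z
    using mult_left_mono[OF s[of z], of l] l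
    by (simp add: relaxed_potential_def inner_diff_left algebra_simps)
  moreover have "continuous_on UNIV (\<lambda>z. ?Q z - y \<bullet> z)"
    unfolding relaxed_potential_def by (intro continuous_intros cont)
  ultimately obtain u where u: "\<And>z. ?Q u - y \<bullet> u \<le> ?Q z - y \<bullet> z"
    using l by (rule_tac minimizer_if_quadratic_minorant[of "\<lambda>z. ?Q z - y \<bullet> z" "1 - l"]) auto
  have y: "y \<in> subdifferential ?Q u"
    using u by (auto simp: subdifferential_def inner_diff_right algebra_simps)
  \<comment> \<open>Solves \<open>l *\<^sub>R x + (1 - l) *\<^sub>R u = y\<close>, the optimality
    condition linking the two problems.\<close>
  define x where "x = (1 / l) *\<^sub>R (y - (1 - l) *\<^sub>R u)"
  have x: "x \<in> subdifferential P u"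
    unfolding x_def by (rule subgradient_remove_quadratic[OF conv l(1) y])
  have Qy: "implicit_regularizer ?Q y = u \<bullet> y - ?Q u - 1 / 2 * (norm y)\<^sup>2"
    by (simp add: implicit_regularizer_def conjugate_at_subgradient[OF y])
  \<comment> \<open>Completing the square: with \<open>u\<close> fixed, Fenchel-Young bounds the envelope below, and the bound
    is attained where the square vanishes.\<close>
  have square: "l * (u \<bullet> z - P u - 1 / 2 * (norm z)\<^sup>2 + 1 / (2 * (1 - l)) * (norm (z - y))\<^sup>2)
      = implicit_regularizer ?Q y + 1 / (2 * (1 - l)) * (norm (l *\<^sub>R z - y + (1 - l) *\<^sub>R u))\<^sup>2" for z
  proof -
    have "(norm (l *\<^sub>R z - y + (1 - l) *\<^sub>R u))\<^sup>2
        = l\<^sup>2 * (z \<bullet> z) + y \<bullet> y + (1 - l)\<^sup>2 * (u \<bullet> u) - 2 * l * (z \<bullet> y)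
          + 2 * l * (1 - l) * (u \<bullet> z) - 2 * (1 - l) * (u \<bullet> y)"
      unfolding power2_norm_eq_inner
      by (simp add: inner_add_left inner_add_right inner_diff_left inner_diff_right inner_commute
          power2_eq_square algebra_simps)
    note square1 = this
    have square2: "(norm (z - y))\<^sup>2 = z \<bullet> z - 2 * (z \<bullet> y) + y \<bullet> y"
      unfolding power2_norm_eq_inner by (simp add: inner_diff_left inner_diff_right inner_commute)
    show ?thesis
      unfolding square1 square2 Qy relaxed_potential_def unfolding power2_norm_eq_inner
      using l by (simp add: field_simps power2_eq_square)
  qed
  have "moreau_envelope (1 - l) (implicit_regularizer P) y = implicit_regularizer ?Q y / l"
    unfolding moreau_envelope_def
  proof (rule cInf_eq_minimum)
    have "l *\<^sub>R x - y + (1 - l) *\<^sub>R u = 0"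
      using l by (simp add: x_def)
    then have "implicit_regularizer ?Q y / l
        = implicit_regularizer P x + 1 / (2 * (1 - l)) * (norm (x - y))\<^sup>2"
      using square[of x] l
      by (simp add: implicit_regularizer_def conjugate_at_subgradient[OF x] field_simps)
    then show "implicit_regularizer ?Q y / l
        \<in> range (\<lambda>x. implicit_regularizer P x + 1 / (2 * (1 - l)) * (norm (x - y))\<^sup>2)"
      by blast
  next
    fix r assume "r \<in> range (\<lambda>x. implicit_regularizer P x + 1 / (2 * (1 - l)) * (norm (x - y))\<^sup>2)"
    then obtain z where z: "r = implicit_regularizer P z + 1 / (2 * (1 - l)) * (norm (z - y))\<^sup>2"
      by blast
    have "implicit_regularizer ?Q y
        \<le> l * (u \<bullet> z - P u - 1 / 2 * (norm z)\<^sup>2 + 1 / (2 * (1 - l)) * (norm (z - y))\<^sup>2)"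
      unfolding square using l by simp
    also have "\<dots> \<le> l * r"
      using l conjugate_upper[OF bdd, of u z] by (simp add: z implicit_regularizer_def)
    finally show "implicit_regularizer ?Q y / l \<le> r"
      using l by (simp add: field_simps)
  qed
  then show ?thesis using l by simp
qed

subsection \<open>Input convex networks\<close>

lemma lipschitz_on_sum:
  fixes g :: "'i \<Rightarrow> 'a::metric_space \<Rightarrow> 'b::real_normed_vector"
  assumes "finite I" and "\<And>i. i \<in> I \<Longrightarrow> \<exists>C. C-lipschitz_on S (g i)"
  shows "\<exists>C. C-lipschitz_on S (\<lambda>x. \<Sum>i\<in>I. g i x)"
  using assms
proof (induction I)
  case empty
  then show ?case by (auto intro: lipschitz_on_constant)
next
  case (insert i I)
  then obtain C D where "C-lipschitz_on S (g i)" "D-lipschitz_on S (\<lambda>x. \<Sum>i\<in>I. g i x)"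
    by (meson insertCI)
  then show ?case using insert.hyps lipschitz_on_add by fastforce
qed

lemma icnn_state_lipschitz:
  assumes "C-lipschitz_on UNIV \<sigma>"
  shows "\<exists>D. D-lipschitz_on UNIV (\<lambda>x. icnn_state \<sigma> \<theta> x i r)"
\<comment> \<open>A layer sums over all components of the previous one, so the induction quantifies
  over \<open>r\<close>.\<close>
proof (induction i arbitrary: r)
  case 0
  then show ?case by (auto intro: lipschitz_on_constant)
next
  case (Suc i)
  have "\<exists>D. D-lipschitz_on UNIV (\<lambda>x. \<Sum>c<width \<theta> i. weight \<theta> i r c * icnn_state \<sigma> \<theta> x i c)"
  proof (rule lipschitz_on_sum)
    fix c
    obtain D where "D-lipschitz_on UNIV (\<lambda>x. icnn_state \<sigma> \<theta> x i c)" using Suc by blast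
    from lipschitz_on_cmult_real[OF this]
    show "\<exists>D. D-lipschitz_on UNIV (\<lambda>x. weight \<theta> i r c * icnn_state \<sigma> \<theta> x i c)" by blast
  qed simp
  moreover have "(norm (skip \<theta> i r))-lipschitz_on UNIV (\<lambda>x. skip \<theta> i r \<bullet> x)"
    by (rule lipschitz_onI)
      (auto simp: dist_norm real_norm_def inner_diff_right[symmetric] Cauchy_Schwarz_ineq2)
  ultimately obtain D E where "(D + E)-lipschitz_on UNIV (\<lambda>x.
      (\<Sum>c<width \<theta> i. weight \<theta> i r c * icnn_state \<sigma> \<theta> x i c) + skip \<theta> i r \<bullet> x)"
    using lipschitz_on_add by blast
  from lipschitz_on_add[OF this lipschitz_on_constant[of UNIV "bias \<theta> i r"]]
  obtain E where "E-lipschitz_on UNIV (\<lambda>x.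
      (\<Sum>c<width \<theta> i. weight \<theta> i r c * icnn_state \<sigma> \<theta> x i c) + skip \<theta> i r \<bullet> x + bias \<theta> i r)"
    by blast
  from lipschitz_on_compose2[OF this lipschitz_on_subset[OF assms subset_UNIV]]
  show ?case by auto
qed

text \<open>The factor gained by the scaled activation is cancelled by the weights where a state
  enters the next layer; skip connections and biases see no scaled quantity and stay as they
  are.\<close>

lemma icnn_state_scale:
  assumes "l \<noteq> 0"
  shows "icnn_state (\<lambda>s. l * \<sigma> s) (\<theta>\<lparr>weight := \<lambda>i r c. weight \<theta> i r c / l\<rparr>) x i r
    = l * icnn_state \<sigma> \<theta> x i r"
  by (induction i arbitrary: r) (use assms in simp_all)

text \<open>The relaxed potential is \<open>l\<close> times the old network plus a quadratic, so
  rescaled parameters bring it into LPN form, and all LPN facts become available for the relaxed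
  map.\<close>

lemma relaxed_map_is_lpn:
  assumes lpn: "is_lpn \<sigma> \<theta> \<alpha> f" and l: "0 < l" "l < 1"
  shows "\<exists>\<sigma>' \<theta>' \<alpha>'. is_lpn \<sigma>' \<theta>' \<alpha>' (relaxed_map l f)
    \<and> lpn_potential \<sigma>' \<theta>' \<alpha>' = relaxed_potential l (lpn_potential \<sigma> \<theta> \<alpha>)"
proof -
  let ?\<sigma> = "\<lambda>s. l * \<sigma> s" and ?\<theta> = "\<theta>\<lparr>weight := \<lambda>i r c. weight \<theta> i r c / l\<rparr>"
  \<comment> \<open>The total quadratic coefficient of the relaxed potential: a convex combination
    of 1 and \<open>\<alpha>\<close>, hence again in (0,1).\<close>
  let ?\<alpha> = "1 - l + l * \<alpha>"
  have icnn: "icnn ?\<sigma> ?\<theta> = (\<lambda>x. l * icnn \<sigma> \<theta> x)"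
    using l by (auto simp: icnn_def icnn_state_scale)
  obtain C where C: "C-lipschitz_on UNIV \<sigma>" using lpn by (auto simp: is_lpn_def)
  have "0 < ?\<alpha>" "?\<alpha> < 1"
    using lpn l by (simp_all add: is_lpn_def add_pos_pos)
  moreover have "is_icnn ?\<sigma> ?\<theta>"
    using lpn l by (auto simp: is_lpn_def is_icnn_def intro!: convex_on_cmul monoI mult_left_mono dest: monoD)
  moreover have "\<exists>C. C-lipschitz_on UNIV ?\<sigma>"
    using lipschitz_on_cmult_real[OF C] by blast
  moreover have "\<exists>v \<in> subdifferential (icnn ?\<sigma> ?\<theta>) y. relaxed_map l f y = v + ?\<alpha> *\<^sub>R y" for y
  proof -
    obtain v where v: "v \<in> subdifferential (icnn \<sigma> \<theta>) y" "f y = v + \<alpha> *\<^sub>R y"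
      using lpn by (auto simp: is_lpn_def)
    have "l * (icnn \<sigma> \<theta> y + v \<bullet> (z - y)) \<le> l * icnn \<sigma> \<theta> z" for z
      using v(1) l by (intro mult_left_mono) (auto simp: subdifferential_def)
    then have "l *\<^sub>R v \<in> subdifferential (icnn ?\<sigma> ?\<theta>) y"
      unfolding icnn subdifferential_def by (simp add: distrib_left)
    moreover have "relaxed_map l f y = l *\<^sub>R v + ?\<alpha> *\<^sub>R y"
      by (simp add: relaxed_map_def v(2) algebra_simps)
    ultimately show ?thesis by blast
  qed
  ultimately have "is_lpn ?\<sigma> ?\<theta> ?\<alpha> (relaxed_map l f)"
    by (simp add: is_lpn_def)
  moreover have "lpn_potential ?\<sigma> ?\<theta> ?\<alpha> = relaxed_potential l (lpn_potential \<sigma> \<theta> \<alpha>)"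
    by (auto simp: lpn_potential_def relaxed_potential_def icnn field_simps)
  ultimately show ?thesis by blast
qed

text \<open>The quadratic exceeds its tangent by
  \<open>\<alpha> / 2 * (norm (z - y))\<^sup>2\<close>, so its gradient can be added to a
  subgradient of the network.\<close>

lemma lpn_subgradient:
  assumes "is_lpn \<sigma> \<theta> \<alpha> f"
  shows "f y \<in> subdifferential (lpn_potential \<sigma> \<theta> \<alpha>) y"
  unfolding subdifferential_def
proof (rule CollectI, rule allI)
  fix z
  obtain v where v: "v \<in> subdifferential (icnn \<sigma> \<theta>) y" "f y = v + \<alpha> *\<^sub>R y"
    using assms by (auto simp: is_lpn_def)
  have subgrad: "icnn \<sigma> \<theta> y + v \<bullet> (z - y) \<le> icnn \<sigma> \<theta> z"
    using v(1) unfolding subdifferential_def by blast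
  have "(norm z)\<^sup>2 = (norm y)\<^sup>2 + 2 * (y \<bullet> (z - y)) + (norm (z - y))\<^sup>2"
    unfolding power2_norm_eq_inner by (simp add: inner_diff_left inner_diff_right inner_commute)
  then have "\<alpha> / 2 * (norm z)\<^sup>2 = \<alpha> / 2 * (norm y)\<^sup>2 + \<alpha> * (y \<bullet> (z - y)) + \<alpha> / 2 * (norm (z - y))\<^sup>2"
    by (simp add: distrib_left)
  moreover have "0 \<le> \<alpha> / 2 * (norm (z - y))\<^sup>2" using assms by (simp add: is_lpn_def)
  ultimately show "lpn_potential \<sigma> \<theta> \<alpha> y + f y \<bullet> (z - y) \<le> lpn_potential \<sigma> \<theta> \<alpha> z"
    unfolding lpn_potential_def v(2) inner_add_left inner_scaleR_left using subgrad by linarith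
qed

text \<open>Evaluate the supremum of the conjugate at \<open>y\<close> itself. The network grows at
  most linearly, so the quadratic coefficient left over is \<open>1 - \<alpha> / 2 - 1 / 2\<close>,
  positive since \<open>\<alpha> < 1\<close>; this is the source of coercivity.\<close>

lemma lpn_implicit_regularizer_minorant:
  assumes lpn: "is_lpn \<sigma> \<theta> \<alpha> f"
  obtains C where "\<And>y. (1 - \<alpha>) / 2 * (norm y)\<^sup>2 - C * norm y - icnn \<sigma> \<theta> 0
    \<le> implicit_regularizer (lpn_potential \<sigma> \<theta> \<alpha>) y"
proof -
  obtain C where C: "C-lipschitz_on UNIV (icnn \<sigma> \<theta>)"
    using lpn icnn_state_lipschitz unfolding icnn_def is_lpn_def by blast
  show thesis
  proof (rule that[of C])
    fix y
    have "icnn \<sigma> \<theta> y \<le> icnn \<sigma> \<theta> 0 + C * norm y"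
      using lipschitz_onD[OF C, of y 0] by (simp add: dist_norm)
    moreover have "y \<bullet> y - lpn_potential \<sigma> \<theta> \<alpha> y \<le> convex_conjugate (lpn_potential \<sigma> \<theta> \<alpha>) y"
      by (rule conjugate_upper[OF lpn_conjugate_finite[OF lpn]])
    ultimately show "(1 - \<alpha>) / 2 * (norm y)\<^sup>2 - C * norm y - icnn \<sigma> \<theta> 0
      \<le> implicit_regularizer (lpn_potential \<sigma> \<theta> \<alpha>) y"
      by (simp add: implicit_regularizer_def lpn_potential_def power2_norm_eq_inner algebra_simps
          add_divide_distrib diff_divide_distrib)
  qed
qed

subsection \<open>Gradients\<close>

lemma GDERIV_unique:
  assumes "GDERIV F x :> v" "GDERIV F x :> w"
  shows "v = w"
proof -
  have "(\<lambda>h. h \<bullet> v) = (\<lambda>h. h \<bullet> w)"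
    using assms unfolding gderiv_def by (rule has_derivative_unique)
  then have "\<forall>h. h \<bullet> v = h \<bullet> w" by (intro allI) (rule fun_cong)
  then show ?thesis by (simp only: vector_eq_ldot)
qed

lemma gradient_eqI: "GDERIV F x :> v \<Longrightarrow> gradient F x = v"
  unfolding gradient_def by (rule the_equality) (auto intro: GDERIV_unique)

text \<open>Riesz representation: the gradient is the adjoint of the derivative applied to
  1.\<close>

lemma GDERIV_gradient:
  fixes F :: "'a::euclidean_space \<Rightarrow> real"
  assumes "F differentiable (at x)"
  shows "GDERIV F x :> gradient F x"
proof -
  obtain D where D: "(F has_derivative D) (at x)" using assms by (auto simp: differentiable_def)
  then have "bounded_linear D" by (rule has_derivative_bounded_linear)
  then have "D = (\<lambda>h. h \<bullet> adjoint D 1)"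
    using adjoint_works[of D _ 1] by (auto simp: bounded_linear.linear)
  with D have "GDERIV F x :> adjoint D 1" by (simp add: gderiv_def)
  then show ?thesis using gradient_eqI by metis
qed

text \<open>Subtracting the linear function of \<open>w\<close> makes \<open>x\<close> a global
  minimizer, so the derivative vanishes; in direction \<open>v - w\<close> it is the squared norm of
  \<open>v - w\<close>.\<close>

lemma subgradient_eq_gradient:
  fixes g :: "'a::euclidean_space \<Rightarrow> real"
  assumes g: "GDERIV g x :> v" and w: "w \<in> subdifferential g x"
  shows "w = v"
proof -
  have "((\<lambda>z. g z - w \<bullet> z) has_derivative (\<lambda>h. h \<bullet> v - w \<bullet> h)) (at x)"
    using g unfolding gderiv_def by (auto intro!: derivative_eq_intros)
  moreover have "\<forall>\<^sub>F z in at x. g x - w \<bullet> x \<le> g z - w \<bullet> z"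
    using w by (intro always_eventually) (auto simp: subdifferential_def inner_diff_right algebra_simps)
  ultimately have "(\<lambda>h. h \<bullet> v - w \<bullet> h) = (\<lambda>h. 0)"
    by (rule has_derivative_local_min)
  then have "(v - w) \<bullet> v - w \<bullet> (v - w) = 0" by metis
  then have "(v - w) \<bullet> (v - w) = 0" by (simp add: inner_diff_left inner_diff_right inner_commute)
  then show ?thesis by simp
qed

lemma descent_lemma:
  assumes F: "smooth_with L F"
  shows "F y \<le> F x + gradient F x \<bullet> (y - x) + L / 2 * (norm (y - x))\<^sup>2"
proof -
  define d where "d = y - x"
  \<comment> \<open>The claim is \<open>h 1 \<le> h 0\<close>. The Lipschitz gradient makes the
    derivative of \<open>h\<close> nonpositive on the segment, which replaces integration.\<close>
  define h where "h t = F (x + t *\<^sub>R d) - t * (gradient F x \<bullet> d) - L / 2 * t\<^sup>2 * (norm d)\<^sup>2" for t :: real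
  have "h 1 \<le> h 0"
  proof (rule DERIV_nonpos_imp_nonincreasing[of 0 1 h])
    fix t :: real assume t: "0 \<le> t" "t \<le> 1"
    let ?g = "gradient F (x + t *\<^sub>R d)"
    have "GDERIV F (x + t *\<^sub>R d) :> ?g"
      using F by (auto simp: smooth_with_def intro: GDERIV_gradient)
    then have "((\<lambda>t. F (x + t *\<^sub>R d)) has_derivative (\<lambda>s. (s *\<^sub>R d) \<bullet> ?g)) (at t)"
      unfolding gderiv_def
      by (rule has_derivative_compose[rotated]) (auto intro!: derivative_eq_intros)
    then have "DERIV (\<lambda>t. F (x + t *\<^sub>R d)) t :> d \<bullet> ?g"
      by (simp add: has_field_derivative_def mult.commute[of _ "d \<bullet> ?g"])
    then have "DERIV h t :> d \<bullet> ?g - gradient F x \<bullet> d - L * t * (norm d)\<^sup>2"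
      unfolding h_def by (auto intro!: derivative_eq_intros)
    moreover have "d \<bullet> ?g - gradient F x \<bullet> d - L * t * (norm d)\<^sup>2 \<le> 0"
    proof -
      have "norm (?g - gradient F x) \<le> L * (t * norm d)"
        using F lipschitz_onD[of L UNIV "gradient F" "x + t *\<^sub>R d" x] t
        by (auto simp: smooth_with_def dist_norm)
      then have "norm (?g - gradient F x) * norm d \<le> L * (t * norm d) * norm d"
        by (rule mult_right_mono) simp
      moreover have "(?g - gradient F x) \<bullet> d \<le> norm (?g - gradient F x) * norm d"
        by (rule norm_cauchy_schwarz)
      ultimately show ?thesis
        by (simp add: inner_diff_left inner_commute power2_eq_square algebra_simps)
    qed
    ultimately show "\<exists>y. DERIV h t :> y \<and> y \<le> 0" by blast
  qed simp
  then show ?thesis by (simp add: h_def d_def)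
qed

subsection \<open>The KL inequality along a descent sequence\<close>

lemma summable_if_nonneg_bounded_sums:
  fixes a :: "nat \<Rightarrow> real"
  assumes "\<And>k. 0 \<le> a k" and "\<And>n. (\<Sum>k<n. a k) \<le> B"
  shows "summable a"
proof (rule bounded_imp_summable)
  show "(\<Sum>k\<le>n. a k) \<le> B" for n using assms(2)[of "Suc n"] by (simp only: lessThan_Suc_atMost)
qed (rule assms(1))

text \<open>A concave graph lies below its tangent at \<open>s\<close>. The tangent point is
  interior to the domain, whereas \<open>t = 0\<close> is allowed although \<open>\<xi>\<close> may
  have no derivative there.\<close>

lemma KL_concave_gap:
  assumes conc: "concave_on {s. 0 \<le> s \<and> ereal s < \<zeta>} \<xi>"
    and der: "(\<xi> has_real_derivative d) (at s)"
    and s: "0 < s" "ereal s < \<zeta>" and t: "0 \<le> t" "t \<le> s"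
  shows "d * (s - t) \<le> \<xi> s - \<xi> t"
proof -
  let ?S = "{s. 0 \<le> s \<and> ereal s < \<zeta>}"
  have "t \<in> ?S" using t s order.strict_trans1[of "ereal t" "ereal s" \<zeta>] by auto
  \<comment> \<open>A finite \<open>b\<close> below \<open>\<zeta>\<close> gives an open interval
    around \<open>s\<close> also when \<open>\<zeta>\<close> is infinite.\<close>
  obtain b where b: "s < b" "ereal b < \<zeta>"
    using ereal_dense2[OF s(2)] by auto
  have int: "s \<in> interior ?S"
  proof (rule interiorI)
    show "{0<..<b} \<subseteq> ?S"
    proof
      fix z assume "z \<in> {0<..<b}"
      then have "0 \<le> z" "ereal z < ereal b" by auto
      with b(2) show "z \<in> ?S" by (blast intro: less_trans)
    qed
  qed (use s b in auto)
  have conv: "convex_on ?S (\<lambda>s. - \<xi> s)" using conc by (simp add: concave_on_def)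
  then have conn: "connected ?S" by (intro convex_connected convex_on_imp_convex)
  have "((\<lambda>s. - \<xi> s) has_field_derivative - d) (at s within ?S)"
    by (rule DERIV_minus[OF has_field_derivative_at_within[OF der]])
  from convex_on_imp_above_tangent[OF conv conn int \<open>t \<in> ?S\<close> this]
  show ?thesis by (simp add: algebra_simps)
qed

text \<open>AM-GM; it will split a product into the previous step length and a telescoping
  difference.\<close>

lemma two_mult_le_if_square_le:
  fixes a b c :: real
  assumes "a\<^sup>2 \<le> b * c" "0 \<le> b" "0 \<le> c"
  shows "2 * a \<le> b + c"
proof -
  have "(2 * a)\<^sup>2 \<le> (b + c)\<^sup>2"
    using assms(1) zero_le_power2[of "b - c"] by (simp add: power2_eq_square algebra_simps)
  then show ?thesis by (rule power2_le_imp_le) (use assms in simp)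
qed

text \<open>KL and the gradient bound give \<open>1 \<le> \<xi>' (a (Suc k)) * (C * d k)\<close>.
  With the decrease and concavity, the squared step is at most the previous step times a difference
  of \<open>b\<close>; AM-GM makes this linear, and the sum telescopes.\<close>

lemma KL_finite_length:
  fixes F :: "'a::euclidean_space \<Rightarrow> real" and x :: "nat \<Rightarrow> 'a"
  assumes KL: "KL_property_at F p"
    and c: "0 < c" "0 < C"
    and decrease: "\<And>k. c * (norm (x (Suc k) - x k))\<^sup>2 \<le> F (x k) - F (x (Suc k))"
    and grad: "\<And>k. norm (gradient F (x (Suc k))) \<le> C * norm (x (Suc k) - x k)"
    and step: "(\<lambda>k. norm (x (Suc k) - x k)) \<longlonglongrightarrow> 0"
    and val: "(\<lambda>k. F (x k)) \<longlonglongrightarrow> F p"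
    and r: "strict_mono (r :: nat \<Rightarrow> nat)" "(x \<circ> r) \<longlonglongrightarrow> p"
  shows "summable (\<lambda>k. norm (x (Suc k) - x k))"
proof -
  obtain \<zeta> :: ereal and U \<xi> \<xi>' where \<zeta>: "0 < \<zeta>" and U: "p \<in> interior U"
    and cont: "continuous_on {s. 0 \<le> s \<and> ereal s < \<zeta>} \<xi>"
    and conc: "concave_on {s. 0 \<le> s \<and> ereal s < \<zeta>} \<xi>"
    and nonneg: "\<And>s. 0 \<le> s \<Longrightarrow> ereal s < \<zeta> \<Longrightarrow> 0 \<le> \<xi> s"
    and \<xi>0: "\<xi> 0 = 0"
    and der: "\<And>s. 0 < s \<Longrightarrow> ereal s < \<zeta> \<Longrightarrow> (\<xi> has_real_derivative \<xi>' s) (at s)"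
    and pos: "\<And>s. 0 < s \<Longrightarrow> ereal s < \<zeta> \<Longrightarrow> 0 < \<xi>' s"
    and kl: "\<And>y. y \<in> U \<Longrightarrow> F p < F y \<Longrightarrow> ereal (F y) < ereal (F p) + \<zeta>
      \<Longrightarrow> 1 \<le> \<xi>' (F y - F p) * norm (gradient F y)"
    using KL unfolding KL_property_at_def by (elim exE conjE) (rule that, (assumption | blast)+)
  define d where "d k = norm (x (Suc k) - x k)" for k
  define a where "a k = F (x k) - F p" for k
  \<comment> \<open>The factor \<open>C / c\<close> absorbs the constants of the gradient bound and
    of the decrease.\<close>
  define b where "b k = C / c * \<xi> (a k)" for k
  have d0: "0 \<le> d k" for k by (simp add: d_def)
  have dec: "c * (d k)\<^sup>2 \<le> a k - a (Suc k)" for k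
    using decrease[of k] by (simp add: d_def a_def)
  have "decseq (\<lambda>k. a k)"
    using dec c by (intro decseq_SucI) (smt (verit) mult_nonneg_nonneg zero_le_power2)
  moreover have a_lim: "a \<longlonglongrightarrow> 0"
    using tendsto_diff[OF val tendsto_const[of "F p"]] by (simp add: a_def[abs_def])
  ultimately have a0: "0 \<le> a k" for k by (rule decseq_ge)
  obtain \<rho> where \<rho>: "0 < \<rho>" "ball p \<rho> \<subseteq> U"
    using U by (auto simp: mem_interior)
  have ev_\<zeta>: "\<forall>\<^sub>F k in sequentially. ereal (a k) < \<zeta>"
  proof -
    have "(\<lambda>k. ereal (a k)) \<longlonglongrightarrow> ereal 0" using a_lim by (simp only: tendsto_ereal)
    from order_tendstoD(2)[OF this, of \<zeta>] show ?thesis using \<zeta> by (simp add: zero_ereal_def)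
  qed
  have "(\<lambda>k. \<xi> (a k)) \<longlonglongrightarrow> \<xi> 0"
    by (rule continuous_on_tendsto_compose[OF cont a_lim])
      (use \<zeta> ev_\<zeta> a0 in \<open>auto simp: zero_ereal_def\<close>)
  then have b_lim: "b \<longlonglongrightarrow> 0"
    using tendsto_mult_left[of _ "\<xi> 0" sequentially "C / c"] by (simp add: b_def[abs_def] \<xi>0)

  have d_lim: "d \<longlonglongrightarrow> 0" using step by (simp add: d_def[abs_def])
  \<comment> \<open>Budget for staying in the ball: the distance of the starting iterate from
    \<open>p\<close>, the step leading into it and its \<open>b\<close> value are each below
    \<open>\<rho> / 4\<close>.\<close>
  have near: "\<forall>\<^sub>F k in sequentially. ereal (a k) < \<zeta> \<and> d k < \<rho> / 4 \<and> b k < \<rho> / 4"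
    using ev_\<zeta> order_tendstoD(2)[OF d_lim, of "\<rho> / 4"] order_tendstoD(2)[OF b_lim, of "\<rho> / 4"] \<rho>(1)
    by (simp add: eventually_conj)
  then obtain N where N: "\<And>k. k \<ge> N \<Longrightarrow> ereal (a k) < \<zeta> \<and> d k < \<rho> / 4 \<and> b k < \<rho> / 4"
    by (auto simp: eventually_sequentially)
  have b0: "0 \<le> b k" if "k \<ge> N" for k
    using nonneg[OF a0] N[OF that] c by (simp add: b_def)
  have "\<forall>\<^sub>F j in sequentially. dist ((x \<circ> r) j) p < \<rho> / 4"
    using tendstoD[OF r(2), of "\<rho> / 4"] \<rho>(1) by simp
  then obtain J where J: "\<And>j. j \<ge> J \<Longrightarrow> dist (x (r j)) p < \<rho> / 4"
    by (auto simp: eventually_sequentially)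
  define j where "j = max J (Suc N)"
  \<comment> \<open>The starting iterate is written \<open>x (Suc m)\<close> because
    \<open>step_ineq\<close> also involves the step leading into a point.\<close>
  have "Suc N \<le> r j" using seq_suble[OF r(1), of j] by (simp add: j_def)
  then obtain m where m: "r j = Suc m" "N \<le> m" by (metis Suc_le_D Suc_le_mono)
  have start: "dist (x (Suc m)) p < \<rho> / 4" using J[of j] m by (simp add: j_def)
  \<comment> \<open>Concavity turns decrease of \<open>F\<close> into decrease of \<open>\<xi> (a k)\<close>; once \<open>a\<close> has reached 0 the KL
    inequality is void, but the sequence is then constant.\<close>
  have step_ineq: "2 * d (Suc k) \<le> d k + (b (Suc k) - b (Suc (Suc k)))"
    if k: "k \<ge> N" "x (Suc k) \<in> U" for k
  proof (cases "a (Suc k) = 0")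
    case True
    then have "c * (d (Suc k))\<^sup>2 \<le> 0" "a (Suc (Suc k)) = 0"
      using dec[of "Suc k"] a0[of "Suc (Suc k)"] c by (smt (verit) mult_nonneg_nonneg zero_le_power2)+
    then have "d (Suc k) = 0" using c by (simp add: mult_le_0_iff)
    then show ?thesis using True \<open>a (Suc (Suc k)) = 0\<close> d0[of k] by (simp add: b_def)
  next
    case False
    let ?s = "a (Suc k)" and ?t = "a (Suc (Suc k))"
    have s: "0 < ?s" "ereal ?s < \<zeta>" using False a0[of "Suc k"] N[of "Suc k"] k by auto
    have "?t \<le> ?s" using \<open>decseq a\<close> by (simp add: decseq_Suc_iff)
    then have gap: "\<xi>' ?s * (?s - ?t) \<le> \<xi> ?s - \<xi> ?t"
      by (intro KL_concave_gap[OF conc der] s a0)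
    have "ereal (F (x (Suc k))) < ereal (F p) + \<zeta>"
      using s(2) by (cases \<zeta>) (auto simp: a_def)
    then have "1 \<le> \<xi>' ?s * norm (gradient F (x (Suc k)))"
      using kl[OF k(2)] s(1) by (simp add: a_def)
    also have "\<dots> \<le> \<xi>' ?s * (C * d k)"
      using grad[of k] pos[OF s] by (intro mult_left_mono) (auto simp: d_def)
    \<comment> \<open>Multiplying the decrease by a factor at least 1 brings in
      \<open>\<xi>'\<close>, so that concavity applies.\<close>
    finally have "c * (d (Suc k))\<^sup>2 * 1 \<le> (?s - ?t) * (\<xi>' ?s * (C * d k))"
      using dec[of "Suc k"] \<open>?t \<le> ?s\<close> c by (intro mult_mono) auto
    also have "\<dots> = (\<xi>' ?s * (?s - ?t)) * (C * d k)" by simp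
    also have "\<dots> \<le> (\<xi> ?s - \<xi> ?t) * (C * d k)"
      using gap c d0 by (intro mult_right_mono) auto
    finally have "(d (Suc k))\<^sup>2 \<le> d k * (b (Suc k) - b (Suc (Suc k)))"
      using c by (simp add: b_def field_simps)
    moreover have "0 \<le> \<xi> ?s - \<xi> ?t"
      using gap pos[OF s] \<open>?t \<le> ?s\<close> by (smt (verit) mult_nonneg_nonneg)
    then have "0 \<le> b (Suc k) - b (Suc (Suc k))"
      using c by (simp add: b_def divide_right_mono)
    ultimately show ?thesis by (intro two_mult_le_if_square_le d0)
  qed
  \<comment> \<open>The bound on the sum keeps the iterates in \<open>U\<close>, where \<open>step_ineq\<close> applies, so both parts
    are carried through the induction together.\<close>
  have sum_bound: "(\<Sum>i<n. d (Suc m + i)) + d (m + n) \<le> d m + b (Suc m) - b (Suc m + n)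
      \<and> norm (x (Suc m + n) - x (Suc m)) \<le> (\<Sum>i<n. d (Suc m + i))" for n
  proof (induction n)
    case (Suc n)
    have "dist (x (Suc m + n)) (x (Suc m)) \<le> d m + b (Suc m)"
      using Suc d0[of "m + n"] b0[of "Suc m + n"] m(2) by (simp add: dist_norm)
    then have "dist (x (Suc m + n)) p < \<rho>"
      using start N[of m] N[of "Suc m"] m(2) dist_triangle[of "x (Suc m + n)" p "x (Suc m)"] \<rho>(1)
      by simp
    then have "x (Suc (m + n)) \<in> U" using \<rho>(2) by (auto simp: dist_commute)
    then have "2 * d (Suc (m + n)) \<le> d (m + n) + (b (Suc (m + n)) - b (Suc (Suc (m + n))))"
      using m(2) by (intro step_ineq) auto
    moreover have "norm (x (Suc m + Suc n) - x (Suc m))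
        \<le> d (Suc m + n) + norm (x (Suc m + n) - x (Suc m))"
      using norm_triangle_ineq[of "x (Suc m + Suc n) - x (Suc m + n)" "x (Suc m + n) - x (Suc m)"]
      by (simp add: d_def)
    ultimately show ?case using Suc by simp
  qed simp
  have "summable (\<lambda>i. d (Suc m + i))"
  proof (rule summable_if_nonneg_bounded_sums)
    show "(\<Sum>i<n. d (Suc m + i)) \<le> d m + b (Suc m)" for n
      using sum_bound[of n] d0[of "m + n"] b0[of "Suc m + n"] m(2) by simp
  qed (rule d0)
  then have "summable d"
    using summable_iff_shift[of d "Suc m"] by (simp add: add.commute)
  then show ?thesis by (simp add: d_def[abs_def])
qed

lemma convergent_if_summable_steps:
  fixes x :: "nat \<Rightarrow> 'a::banach"
  assumes "summable (\<lambda>k. norm (x (Suc k) - x k))"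
  shows "convergent x"
proof -
  have "summable (\<lambda>k. x (Suc k) - x k)" by (rule summable_norm_cancel[OF assms])
  then have "convergent (\<lambda>n. \<Sum>k<n. x (Suc k) - x k)" by (simp add: summable_iff_convergent)
  then have "convergent (\<lambda>n. (\<Sum>k<n. x (Suc k) - x k) + x 0)"
    by (intro convergent_add convergent_const)
  then show ?thesis by (simp add: sum_lessThan_telescope)
qed

subsection \<open>Proximal gradient steps\<close>

text \<open>Testing the subgradient at \<open>x\<close> and polarizing the inner product leaves
  exactly half the squared step; the descent lemma uses up the fraction \<open>\<eta> * L\<close> of
  it.\<close>

lemma proximal_gradient_decrease:
  fixes g H :: "'a::euclidean_space \<Rightarrow> real"
  assumes g: "smooth_with L g" and "0 < \<eta>"
    and y: "x - \<eta> *\<^sub>R gradient g x \<in> subdifferential H y"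
  shows "(1 - \<eta> * L) / 2 * (norm (y - x))\<^sup>2
    \<le> (\<eta> * g x + (H x - 1 / 2 * (norm x)\<^sup>2)) - (\<eta> * g y + (H y - 1 / 2 * (norm y)\<^sup>2))"
proof -
  have "H y + (x - \<eta> *\<^sub>R gradient g x) \<bullet> (x - y) \<le> H x"
    using y unfolding subdifferential_def by blast
  moreover have "(x - \<eta> *\<^sub>R gradient g x) \<bullet> (x - y)
      = 1 / 2 * (norm x)\<^sup>2 - 1 / 2 * (norm y)\<^sup>2 + 1 / 2 * (norm (y - x))\<^sup>2
        + \<eta> * (gradient g x \<bullet> (y - x))"
    unfolding power2_norm_eq_inner
    by (simp add: inner_diff_left inner_diff_right inner_commute algebra_simps)
  moreover have "\<eta> * g y \<le> \<eta> * (g x + gradient g x \<bullet> (y - x) + L / 2 * (norm (y - x))\<^sup>2)"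
    using descent_lemma[OF g, of y x] \<open>0 < \<eta>\<close> by (intro mult_left_mono) auto
  moreover have "\<eta> * (g x + gradient g x \<bullet> (y - x) + L / 2 * (norm (y - x))\<^sup>2)
      = \<eta> * g x + \<eta> * (gradient g x \<bullet> (y - x)) + \<eta> * L / 2 * (norm (y - x))\<^sup>2"
    by (simp add: distrib_left)
  moreover have "(1 - \<eta> * L) / 2 * (norm (y - x))\<^sup>2
      = 1 / 2 * (norm (y - x))\<^sup>2 - \<eta> * L / 2 * (norm (y - x))\<^sup>2"
    by (simp add: diff_divide_distrib left_diff_distrib)
  ultimately show ?thesis by linarith
qed

text \<open>\<open>H\<close> equals \<open>F - \<eta> * g\<close> plus half the squared norm, so it
  is differentiable at \<open>y\<close> together with \<open>F\<close>. Its subgradient is then its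
  gradient, and the equation is solved for \<open>gradient F y\<close>.\<close>

lemma proximal_gradient_gradient_bound:
  fixes g H :: "'a::euclidean_space \<Rightarrow> real"
  assumes g: "smooth_with L g" and "0 < \<eta>"
    and y: "x - \<eta> *\<^sub>R gradient g x \<in> subdifferential H y"
    and F: "F = (\<lambda>z. \<eta> * g z + (H z - 1 / 2 * (norm z)\<^sup>2))" and "F differentiable (at y)"
  shows "norm (gradient F y) \<le> (1 + \<eta> * L) * norm (y - x)"
proof -
  have "GDERIV F y :> gradient F y" "GDERIV g y :> gradient g y"
    using assms by (auto simp: smooth_with_def intro: GDERIV_gradient)
  then have "GDERIV (\<lambda>z. F z - \<eta> * g z + 1 / 2 * (z \<bullet> z)) y :> gradient F y - \<eta> *\<^sub>R gradient g y + y"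
    unfolding gderiv_def
    by (auto intro!: derivative_eq_intros simp: inner_diff_right inner_add_right inner_commute)
  moreover have "(\<lambda>z. F z - \<eta> * g z + 1 / 2 * (z \<bullet> z)) = H"
    by (auto simp: F power2_norm_eq_inner)
  ultimately have "x - \<eta> *\<^sub>R gradient g x = gradient F y - \<eta> *\<^sub>R gradient g y + y"
    using subgradient_eq_gradient[OF _ y] by metis
  then have "gradient F y = \<eta> *\<^sub>R (gradient g y - gradient g x) - (y - x)"
    by (simp add: algebra_simps)
  then have "norm (gradient F y) \<le> \<eta> * norm (gradient g y - gradient g x) + norm (y - x)"
    using norm_triangle_ineq4[of "\<eta> *\<^sub>R (gradient g y - gradient g x)" "y - x"] \<open>0 < \<eta>\<close> by simp
  moreover have "norm (gradient g y - gradient g x) \<le> L * norm (y - x)"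
    using g lipschitz_onD[of L UNIV "gradient g" y x] by (auto simp: smooth_with_def dist_norm)
  then have "\<eta> * norm (gradient g y - gradient g x) \<le> \<eta> * (L * norm (y - x))"
    using \<open>0 < \<eta>\<close> by (intro mult_left_mono) auto
  ultimately show ?thesis by (simp add: distrib_right)
qed

section \<open>Scalar quadratic estimates for coercivity\<close>

lemma quadratic_lower_bound:
  fixes a C r :: real
  assumes "0 < a"
  shows "- (C\<^sup>2 / (4 * a)) \<le> a * r\<^sup>2 - C * r"
proof -
  have "0 \<le> (2 * a * r - C)\<^sup>2 / (4 * a)" using assms by simp
  also have "\<dots> = a * r\<^sup>2 - C * r + C\<^sup>2 / (4 * a)"
    using assms by (simp add: field_simps power2_eq_square)
  finally show ?thesis by simp
qed

text \<open>For \<open>r > 1\<close> the lower-order terms are together at most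
  \<open>(\<bar>C\<bar> + \<bar>K\<bar>) * r\<close>, and one factor \<open>r\<close>
  cancels.\<close>

lemma quadratic_sublevel_bound:
  fixes a C K r :: real
  assumes "0 < a" "a * r\<^sup>2 - C * r \<le> K"
  shows "r \<le> 1 + (\<bar>C\<bar> + \<bar>K\<bar>) / a"
proof (cases "r \<le> 1")
  case True
  have "0 \<le> (\<bar>C\<bar> + \<bar>K\<bar>) / a" using assms(1) by simp
  with True show ?thesis by linarith
next
  case False
  have "C * r \<le> \<bar>C\<bar> * r" "\<bar>K\<bar> * 1 \<le> \<bar>K\<bar> * r"
    using False by (intro mult_right_mono mult_left_mono; simp)+
  then have "(a * r) * r \<le> (\<bar>C\<bar> + \<bar>K\<bar>) * r"
    using assms(2) by (simp add: power2_eq_square algebra_simps)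
  then have "a * r \<le> \<bar>C\<bar> + \<bar>K\<bar>"
    using False by (simp add: mult_le_cancel_right)
  then have "r \<le> (\<bar>C\<bar> + \<bar>K\<bar>) / a"
    using assms(1) by (simp add: pos_le_divide_eq mult.commute)
  then show ?thesis by simp
qed

text \<open>KL is applied at a cluster point \<open>p\<close>; finite length upgrades subsequential
  to full convergence, and the gradient bound with continuity of the gradient makes the limit
  critical.\<close>

lemma KL_descent_convergence:
  fixes F :: "'a::euclidean_space \<Rightarrow> real" and x :: "nat \<Rightarrow> 'a"
  assumes KL: "KL_function F"
    and c: "0 < c" "0 < C"
    and decrease: "\<And>k. c * (norm (x (Suc k) - x k))\<^sup>2 \<le> F (x k) - F (x (Suc k))"
    and grad: "\<And>k. norm (gradient F (x (Suc k))) \<le> C * norm (x (Suc k) - x k)"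
    and step: "(\<lambda>k. norm (x (Suc k) - x k)) \<longlonglongrightarrow> 0"
    and bdd: "bounded (range x)" and conv: "convergent (\<lambda>k. F (x k))"
  shows "summable (\<lambda>k. norm (x (Suc k) - x k))" "\<exists>p. x \<longlonglongrightarrow> p \<and> critical_point F p"
proof -
  have diff: "F differentiable (at y)" and cont_grad: "continuous_on UNIV (gradient F)"
    and KL_at: "KL_property_at F y" for y
    using KL by (auto simp: KL_function_def continuously_differentiable_def)
  obtain p and r :: "nat \<Rightarrow> nat" where r: "strict_mono r" "(x \<circ> r) \<longlonglongrightarrow> p"
    using bounded_imp_convergent_subsequence[OF bdd] by blast
  obtain v where v: "(\<lambda>k. F (x k)) \<longlonglongrightarrow> v" using conv by (auto simp: convergent_def)
  \<comment> \<open>Continuity along the subsequence identifies the limit of all values as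
    \<open>F p\<close>, the base value of the KL inequality.\<close>
  have "isCont F p" by (rule differentiable_imp_continuous_within[OF diff])
  then have "(\<lambda>j. F (x (r j))) \<longlonglongrightarrow> F p"
    using isCont_tendsto_compose[of p F "x \<circ> r"] r(2) by simp
  moreover have "(\<lambda>j. F (x (r j))) \<longlonglongrightarrow> v"
    using LIMSEQ_subseq_LIMSEQ[OF v r(1)] by (simp add: o_def)
  ultimately have "F p = v" by (rule LIMSEQ_unique)
  with v have val: "(\<lambda>k. F (x k)) \<longlonglongrightarrow> F p" by simp
  show sum: "summable (\<lambda>k. norm (x (Suc k) - x k))"
    by (rule KL_finite_length[OF KL_at c decrease grad step val r])
  obtain q where q: "x \<longlonglongrightarrow> q"
    using convergent_if_summable_steps[OF sum] by (auto simp: convergent_def)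
  have "(\<lambda>k. gradient F (x (Suc k))) \<longlonglongrightarrow> gradient F q"
    using continuous_on_tendsto_compose[OF cont_grad LIMSEQ_Suc[OF q]] by simp
  moreover have "(\<lambda>k. gradient F (x (Suc k))) \<longlonglongrightarrow> 0"
  proof (rule Lim_null_comparison)
    show "\<forall>\<^sub>F k in sequentially. norm (gradient F (x (Suc k))) \<le> C * norm (x (Suc k) - x k)"
      using grad by simp
    show "(\<lambda>k. C * norm (x (Suc k) - x k)) \<longlonglongrightarrow> 0"
      using tendsto_mult_left[OF step, of C] by simp
  qed
  ultimately have "gradient F q = 0" by (rule LIMSEQ_unique)
  then have "critical_point F q"
    using GDERIV_gradient[OF diff, of q] by (simp add: critical_point_def)
  with q show "\<exists>p. x \<longlonglongrightarrow> p \<and> critical_point F p" by blast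
qed

section \<open>Convergence of the relaxed iteration\<close>

theorem corollary4p6:
  fixes f :: "real ^ 'n \<Rightarrow> real ^ 'n"
    and \<sigma> :: "real \<Rightarrow> real"
    and \<theta> :: "'n icnn_params"
    and \<alpha> l L \<eta> :: real
    and \<Psi> \<phi> \<Psi>l \<phi>l fid F :: "real ^ 'n \<Rightarrow> real"
    and fl :: "real ^ 'n \<Rightarrow> real ^ 'n"
    and x0 :: "real ^ 'n"
    and x :: "nat \<Rightarrow> real ^ 'n"
  assumes lpn: "is_lpn \<sigma> \<theta> \<alpha> f"
    and \<Psi>: "\<Psi> = lpn_potential \<sigma> \<theta> \<alpha>"
    and \<phi>: "\<phi> = implicit_regularizer \<Psi>"
    and l: "0 < l" "l < 1"
    and fl: "fl = relaxed_map l f"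
    and \<Psi>l: "\<Psi>l = relaxed_potential l \<Psi>"
    and \<phi>l: "\<phi>l = implicit_regularizer \<Psi>l"
    and fid: "0 < L" "smooth_with L fid" "bdd_below (range fid)"
    and \<eta>: "0 < \<eta>" "\<eta> < 1 / L"
    and x_0: "x 0 = x0"
    and x_Suc: "\<And>k. x (Suc k) = fl (x k - \<eta> *\<^sub>R gradient fid (x k))"
    and F: "F = (\<lambda>y. \<eta> * fid y + l * moreau_envelope (1 - l) \<phi> y)"
  shows "(\<exists>\<sigma>' \<theta>' \<alpha>'. is_lpn \<sigma>' \<theta>' \<alpha>' fl \<and> lpn_potential \<sigma>' \<theta>' \<alpha>' = \<Psi>l) \<and>
    \<phi>l = (\<lambda>y. l * moreau_envelope (1 - l) \<phi> y) \<and>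
    (decseq (\<lambda>k. F (x k)) \<and> convergent (\<lambda>k. F (x k))) \<and>
    summable (\<lambda>k. (norm (x (Suc k) - x (Suc (Suc k))))\<^sup>2) \<and>
    (KL_function F \<longrightarrow>
      summable (\<lambda>k. norm (x (Suc k) - x (Suc (Suc k)))) \<and>
      (\<exists>xstar. x \<longlonglongrightarrow> xstar \<and> critical_point F xstar))"
proof -
  \<comment> \<open>With \<open>fl\<close> an LPN in its own right, the subgradient and growth
    results apply directly to \<open>\<Psi>l\<close>.\<close>
  obtain \<sigma>' \<theta>' \<alpha>' where lpn': "is_lpn \<sigma>' \<theta>' \<alpha>' fl" and pot: "lpn_potential \<sigma>' \<theta>' \<alpha>' = \<Psi>l"
    using relaxed_map_is_lpn[OF lpn l] unfolding fl \<Psi>l \<Psi> by blast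
  have sub: "subdifferential \<Psi> y \<noteq> {}" for y
    using lpn_subgradient[OF lpn] unfolding \<Psi> by blast
  have bdd: "bdd_above (range (\<lambda>x. x \<bullet> y - \<Psi> x))" for y
    unfolding \<Psi> by (rule lpn_conjugate_finite[OF lpn])
  have reg: "\<phi>l = (\<lambda>y. l * moreau_envelope (1 - l) \<phi> y)"
    unfolding \<phi>l \<Psi>l \<phi> using implicit_regularizer_relaxed[OF sub bdd l] by blast
  define H where "H = convex_conjugate \<Psi>l"
  have F_eq: "F = (\<lambda>z. \<eta> * fid z + (H z - 1 / 2 * (norm z)\<^sup>2))"
    unfolding F reg[symmetric, THEN fun_cong] \<phi>l implicit_regularizer_def H_def ..
  have "fl w \<in> subdifferential \<Psi>l w" for w
    using lpn_subgradient[OF lpn'] by (simp add: pot)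
  then have "w \<in> subdifferential H (fl w)" for w
    unfolding H_def using lpn_conjugate_finite[OF lpn'] by (intro subgradient_conjugate) (auto simp: pot)
  then have subgrad: "x k - \<eta> *\<^sub>R gradient fid (x k) \<in> subdifferential H (x (Suc k))" for k
    by (simp add: x_Suc)
  define c where "c = (1 - \<eta> * L) / 2"
  have "0 < c" using \<eta> fid(1) by (simp add: c_def field_simps)
  have decrease: "c * (norm (x (Suc k) - x k))\<^sup>2 \<le> F (x k) - F (x (Suc k))" for k
    unfolding F_eq c_def by (rule proximal_gradient_decrease[OF fid(2) \<eta>(1) subgrad])
  have "0 \<le> c * (norm (x (Suc k) - x k))\<^sup>2" for k using \<open>0 < c\<close> by simp
  then have dec: "decseq (\<lambda>k. F (x k))"
    using decrease by (intro decseq_SucI) (metis diff_ge_0_iff_ge order_trans)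

  obtain m where m: "\<And>y. m \<le> fid y" using fid(3) by (auto simp: bdd_below_def)
  obtain C where C: "\<And>y. (1 - \<alpha>') / 2 * (norm y)\<^sup>2 - C * norm y - icnn \<sigma>' \<theta>' 0 \<le> \<phi>l y"
    using lpn_implicit_regularizer_minorant[OF lpn'] unfolding pot \<phi>l by blast
  define a where "a = (1 - \<alpha>') / 2"
  define K where "K = \<eta> * m - icnn \<sigma>' \<theta>' 0"
  have "0 < a" using lpn' by (simp add: a_def is_lpn_def)
  have coercive: "a * (norm y)\<^sup>2 - C * norm y + K \<le> F y" for y
  proof -
    have "\<eta> * m \<le> \<eta> * fid y" using m \<eta>(1) by (intro mult_left_mono) auto
    then show ?thesis using C[of y] by (simp add: F reg a_def K_def)
  qed
  \<comment> \<open>Coercivity serves twice: the minimum of the quadratic bounds the values below,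
    and the sublevel set at \<open>F (x 0)\<close>, which contains all iterates, is bounded.\<close>
  have lower: "K - C\<^sup>2 / (4 * a) \<le> F y" for y
    using coercive[of y] quadratic_lower_bound[OF \<open>0 < a\<close>, of C "norm y"] by linarith
  have conv: "convergent (\<lambda>k. F (x k))"
    using decseq_convergent[OF dec, of "K - C\<^sup>2 / (4 * a)"] lower by (metis convergentI)
  have "norm (x k) \<le> 1 + (\<bar>C\<bar> + \<bar>F (x 0) - K\<bar>) / a" for k
    using coercive[of "x k"] decseqD[OF dec, of 0 k] \<open>0 < a\<close>
    by (intro quadratic_sublevel_bound) auto
  then have bounded: "bounded (range x)" unfolding bounded_iff by blast

  have square_sum: "summable (\<lambda>k. (norm (x (Suc k) - x k))\<^sup>2)"
  proof (rule summable_if_nonneg_bounded_sums)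
    fix n
    have "c * (\<Sum>k<n. (norm (x (Suc k) - x k))\<^sup>2) \<le> (\<Sum>k<n. F (x k) - F (x (Suc k)))"
      unfolding sum_distrib_left by (rule sum_mono[OF decrease])
    also have "\<dots> \<le> F (x 0) - (K - C\<^sup>2 / (4 * a))"
      using sum_lessThan_telescope'[of "\<lambda>k. F (x k)" n] lower[of "x n"] by simp
    finally show "(\<Sum>k<n. (norm (x (Suc k) - x k))\<^sup>2) \<le> (F (x 0) - (K - C\<^sup>2 / (4 * a))) / c"
      using \<open>0 < c\<close> by (simp add: pos_le_divide_eq mult.commute)
  qed simp
  \<comment> \<open>The claimed sums start at \<open>k = 1\<close>, hence the shift by one.\<close>
  then have square_sum': "summable (\<lambda>k. (norm (x (Suc k) - x (Suc (Suc k))))\<^sup>2)"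
    by (subst (asm) summable_Suc_iff[symmetric]) (simp add: norm_minus_commute)
  have step: "(\<lambda>k. norm (x (Suc k) - x k)) \<longlonglongrightarrow> 0"
    using tendsto_real_sqrt[OF summable_LIMSEQ_zero[OF square_sum]] by simp
  have "summable (\<lambda>k. norm (x (Suc k) - x (Suc (Suc k)))) \<and>
      (\<exists>xstar. x \<longlonglongrightarrow> xstar \<and> critical_point F xstar)" if KL: "KL_function F"
  proof -
    \<comment> \<open>Differentiability of \<open>F\<close> is taken from the KL assumption, which
      is why the gradient bound appears only here.\<close>
    have "F differentiable (at y)" for y
      using KL by (simp add: KL_function_def continuously_differentiable_def)
    then have grad: "norm (gradient F (x (Suc k))) \<le> (1 + \<eta> * L) * norm (x (Suc k) - x k)" for k
      by (intro proximal_gradient_gradient_bound[OF fid(2) \<eta>(1) subgrad F_eq])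
    have "0 < 1 + \<eta> * L" using \<eta>(1) fid(1) by (simp add: add_pos_pos)
    note KL_descent = KL_descent_convergence[OF KL \<open>0 < c\<close> this decrease grad step bounded conv]
    have "summable (\<lambda>k. norm (x (Suc k) - x (Suc (Suc k))))"
      using KL_descent(1) by (subst (asm) summable_Suc_iff[symmetric]) (simp add: norm_minus_commute)
    with KL_descent(2) show ?thesis by blast
  qed
  with lpn' pot reg dec conv square_sum' show ?thesis by blast
qed

end
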